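(* For every positive integer $n$, the sequence $(\mathrm{OCPS}^{(n)}(p))_{p=1,\dots,n}$ is logarithmically concave.
   Context: For integers $n,p\ge1$, a partition sequence of $\{1,\dots,n\}$ into $p$ parts is an ordered tuple $(s_1,\dots,s_p)$ of nonempty pairwise disjoint sets with union $\{1,\dots,n\}$. It is order-consecutive if for every $k=1,\dots,p$ the union $\bigcup_{i=1}^k s_i$ is a set of consecutive integers. $\mathrm{OCPS}^{(n)}(p)$ denotes the number of order-consecutive partition sequences of $\{1,\dots,n\}$ into $p$ parts. A sequence of real numbers $(a_p)$ is logarithmically concave (log-concave) if $a_p^2\ge a_{p+1}a_{p-1}$ for all $p$ (for a finite sequence, terms outside the index range are taken to be $0$). *)

theory Defs
  imports Complex_Main "HOL-Library.Disjoint_Sets"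
begin

(* The tuple (s_1, ..., s_p) is a list of length p; s_(i+1) is the list entry with index i. *)
definition partition_sequence :: "nat \<Rightarrow> nat \<Rightarrow> nat set list \<Rightarrow> bool" where
  "partition_sequence n p s \<longleftrightarrow>
     length s = p \<and>
     (\<forall>i<p. s ! i \<noteq> {}) \<and>
     disjoint_family_on (\<lambda>i. s ! i) {..<p} \<and>
     (\<Union>i<p. s ! i) = {1..n}"

definition consecutive :: "nat set \<Rightarrow> bool" where
  "consecutive A \<longleftrightarrow> (\<exists>a b. A = {a..b})"

definition order_consecutive :: "nat set list \<Rightarrow> bool" where
  "order_consecutive s \<longleftrightarrow> (\<forall>k\<in>{1..length s}. consecutive (\<Union>i<k. s ! i))"

definition OCPS :: "nat \<Rightarrow> nat \<Rightarrow> nat" where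
  "OCPS n p = card {s. partition_sequence n p s \<and> order_consecutive s}"

(* The counted set is finite, so the cardinality is the true one and not the default 0. *)
lemma finite_order_consecutive_partition_sequences:
  "finite {s. partition_sequence n p s \<and> order_consecutive s}"
proof (rule finite_subset)
  show "{s. partition_sequence n p s \<and> order_consecutive s}
          \<subseteq> {s. set s \<subseteq> Pow {1..n} \<and> length s = p}"
    by (fastforce simp: partition_sequence_def in_set_conv_nth)
  show "finite {s. set s \<subseteq> Pow {1..n} \<and> length s = p}"
    by (rule finite_lists_length_eq) simp
qed

definition log_concave :: "(int \<Rightarrow> real) \<Rightarrow> bool" where
  "log_concave a \<longleftrightarrow> (\<forall>p. (a p)\<^sup>2 \<ge> a (p + 1) * a (p - 1))"

(* The finite sequence (a_p) for p = l, ..., u, with all other terms taken to be 0. *)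
definition finite_seq :: "nat \<Rightarrow> nat \<Rightarrow> (nat \<Rightarrow> real) \<Rightarrow> int \<Rightarrow> real" where
  "finite_seq l u a p = (if int l \<le> p \<and> p \<le> int u then a (nat p) else 0)"

end

theory Submission
  imports Defs
begin

text \<open>
  An order-consecutive partition sequence of \<open>{1..n}\<close> is the same as a strictly increasing chain
  of \<open>p\<close> nonempty intervals ending in \<open>{1..n}\<close>. For \<open>p \<ge> 2\<close>, removing the last part leaves such a
  sequence for some proper subinterval \<open>{a..b}\<close>, and the number of these depends only on the length
  of \<open>{a..b}\<close>. With \<open>f n p = OCPS n p\<close> and the sums \<open>g n p = f 1 p + \<dots> + f n p\<close>, this
  gives \<open>f n (p + 1) + f n p = g 1 p + \<dots> + g n p\<close> for \<open>p \<ge> 1\<close> (lemma \<open>OCPS_Suc_sum\<close>). Subtracting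
  two consecutive instances yields the subtraction-free system
  \<open>f (n + 1) (p + 1) = f n (p + 1) + f n p + g n p\<close>, \<open>g (n + 1) p = g n p + f (n + 1) p\<close>.

  Sums of log-concave sequences need not be log-concave, so an induction on \<open>n\<close> has to control how
  the rows \<open>x = f n\<close> and \<open>v = g n\<close> are related. The invariant is that on their support the ratios
  \<open>v j / x j\<close> decrease in \<open>j\<close> while the ratios \<open>v j / x (j + 1)\<close> increase; generating polynomials
  with nonnegative coefficients and real, suitably interlacing roots satisfy inequalities of this kind. The invariant makes \<open>x\<close>
  log-concave, because \<open>x (j + 1) / x j = (v j / x j) / (v j / x (j + 1))\<close> then decreases, and in the
  same way it makes \<open>v\<close> log-concave. Lemma \<open>interlaced_step\<close> shows that row \<open>n + 1\<close> inherits it.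
\<close>

section \<open>Interlaced pairs of sequences\<close>

text \<open>
  The ratio conditions are stated without division, so that they remain meaningful beyond the common
  support \<open>{..<n}\<close>; the support is recorded because cancelling in products needs positive factors.
\<close>

definition interlaced :: "nat \<Rightarrow> (nat \<Rightarrow> real) \<Rightarrow> (nat \<Rightarrow> real) \<Rightarrow> bool" where
  "interlaced n x v \<longleftrightarrow>
     (\<forall>j<n. 0 < x j \<and> 0 < v j) \<and> (\<forall>j\<ge>n. x j = 0 \<and> v j = 0) \<and>
     (\<forall>j. v (Suc j) * x j \<le> v j * x (Suc j)) \<and>
     (\<forall>j. v j * x (Suc (Suc j)) \<le> v (Suc j) * x (Suc j))"

context
  fixes n :: nat and x v :: "nat \<Rightarrow> real"
  assumes il: "interlaced n x v"
begin

lemma interlaced_nonneg: "0 \<le> x j" "0 \<le> v j"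
  using il unfolding interlaced_def by (metis less_eq_real_def linorder_not_less)+

lemma interlaced_pos: "j < n \<Longrightarrow> 0 < x j" "j < n \<Longrightarrow> 0 < v j"
  using il unfolding interlaced_def by auto

lemma interlaced_zero: "n \<le> j \<Longrightarrow> x j = 0" "n \<le> j \<Longrightarrow> v j = 0"
  using il unfolding interlaced_def by auto

lemma interlaced_ratio: "v (Suc j) * x j \<le> v j * x (Suc j)"
  using il unfolding interlaced_def by auto

lemma interlaced_shifted_ratio: "v j * x (Suc (Suc j)) \<le> v (Suc j) * x (Suc j)"
  using il unfolding interlaced_def by auto

lemma interlaced_log_concave_fst: "x j * x (Suc (Suc j)) \<le> x (Suc j) * x (Suc j)"
proof (cases "Suc (Suc j) < n")
  case True
  have "(v (Suc j) * x j) * (v j * x (Suc (Suc j))) \<le> (v j * x (Suc j)) * (v (Suc j) * x (Suc j))"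
    by (intro mult_mono interlaced_ratio interlaced_shifted_ratio mult_nonneg_nonneg
        interlaced_nonneg)
  then have "(v j * v (Suc j)) * (x j * x (Suc (Suc j))) \<le> (v j * v (Suc j)) * (x (Suc j) * x (Suc j))"
    by (simp add: mult_ac)
  moreover have "0 < v j * v (Suc j)"
    using True interlaced_pos by simp
  ultimately show ?thesis
    by (simp only: mult_le_cancel_left_pos)
qed (use interlaced_zero in simp)

lemma interlaced_log_concave_snd: "v j * v (Suc (Suc j)) \<le> v (Suc j) * v (Suc j)"
proof (cases "Suc (Suc j) < n")
  case True
  have "(v (Suc (Suc j)) * x (Suc j)) * (v j * x (Suc (Suc j)))
          \<le> (v (Suc j) * x (Suc (Suc j))) * (v (Suc j) * x (Suc j))"
    by (intro mult_mono interlaced_ratio interlaced_shifted_ratio mult_nonneg_nonneg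
        interlaced_nonneg)
  then have "(x (Suc j) * x (Suc (Suc j))) * (v j * v (Suc (Suc j)))
               \<le> (x (Suc j) * x (Suc (Suc j))) * (v (Suc j) * v (Suc j))"
    by (simp add: mult_ac)
  moreover have "0 < x (Suc j) * x (Suc (Suc j))"
    using True interlaced_pos by simp
  ultimately show ?thesis
    by (simp only: mult_le_cancel_left_pos)
qed (use interlaced_zero in simp)

text \<open>
  The three remaining inequalities that \<open>interlaced_step\<close> consumes. Each is obtained by chaining
  two of those above through a common product and cancelling the entry in the middle.
\<close>

lemma interlaced_mixed: "x j * v (Suc (Suc j)) \<le> x (Suc j) * v (Suc j)"
proof (cases "Suc (Suc j) < n")
  case True
  have "x (Suc j) * (x j * v (Suc (Suc j))) = x j * (v (Suc (Suc j)) * x (Suc j))"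
    by (simp add: mult_ac)
  also have "\<dots> \<le> x j * (v (Suc j) * x (Suc (Suc j)))"
    by (intro mult_left_mono interlaced_ratio interlaced_nonneg)
  also have "\<dots> = v (Suc j) * (x j * x (Suc (Suc j)))"
    by (simp add: mult_ac)
  also have "\<dots> \<le> v (Suc j) * (x (Suc j) * x (Suc j))"
    by (intro mult_left_mono interlaced_log_concave_fst interlaced_nonneg)
  also have "\<dots> = x (Suc j) * (x (Suc j) * v (Suc j))"
    by (simp add: mult_ac)
  finally show ?thesis
    using True interlaced_pos(1)[of "Suc j"] by (simp only: mult_le_cancel_left_pos)
qed (use interlaced_zero interlaced_nonneg in simp)

lemma interlaced_far_fst: "x j * x (Suc (Suc (Suc j))) \<le> x (Suc j) * x (Suc (Suc j))"
proof (cases "Suc (Suc (Suc j)) < n")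
  case True
  have "x (Suc (Suc j)) * (x j * x (Suc (Suc (Suc j)))) = (x j * x (Suc (Suc j))) * x (Suc (Suc (Suc j)))"
    by (simp add: mult_ac)
  also have "\<dots> \<le> (x (Suc j) * x (Suc j)) * x (Suc (Suc (Suc j)))"
    by (intro mult_right_mono interlaced_log_concave_fst interlaced_nonneg)
  also have "\<dots> = x (Suc j) * (x (Suc j) * x (Suc (Suc (Suc j))))"
    by (simp add: mult_ac)
  also have "\<dots> \<le> x (Suc j) * (x (Suc (Suc j)) * x (Suc (Suc j)))"
    by (intro mult_left_mono interlaced_log_concave_fst interlaced_nonneg)
  also have "\<dots> = x (Suc (Suc j)) * (x (Suc j) * x (Suc (Suc j)))"
    by (simp add: mult_ac)
  finally show ?thesis
    using True interlaced_pos(1)[of "Suc (Suc j)"] by (simp only: mult_le_cancel_left_pos)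
qed (use interlaced_zero interlaced_nonneg in simp)

lemma interlaced_far_mixed: "v j * x (Suc (Suc (Suc j))) \<le> v (Suc j) * x (Suc (Suc j))"
proof (cases "Suc (Suc (Suc j)) < n")
  case True
  have "x (Suc (Suc j)) * (v j * x (Suc (Suc (Suc j)))) = (v j * x (Suc (Suc j))) * x (Suc (Suc (Suc j)))"
    by (simp add: mult_ac)
  also have "\<dots> \<le> (v (Suc j) * x (Suc j)) * x (Suc (Suc (Suc j)))"
    by (intro mult_right_mono interlaced_shifted_ratio interlaced_nonneg)
  also have "\<dots> = v (Suc j) * (x (Suc j) * x (Suc (Suc (Suc j))))"
    by (simp add: mult_ac)
  also have "\<dots> \<le> v (Suc j) * (x (Suc (Suc j)) * x (Suc (Suc j)))"
    by (intro mult_left_mono interlaced_log_concave_fst interlaced_nonneg)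
  also have "\<dots> = x (Suc (Suc j)) * (v (Suc j) * x (Suc (Suc j)))"
    by (simp add: mult_ac)
  finally show ?thesis
    using True interlaced_pos(1)[of "Suc (Suc j)"] by (simp only: mult_le_cancel_left_pos)
qed (use interlaced_zero interlaced_nonneg in simp)

text \<open>
  In terms of generating polynomials in \<open>y\<close> and \<open>S = X + V\<close>, the step is \<open>X' = X + y S\<close>,
  \<open>V' = (1 + y) S\<close>. Expanding the required inequalities for \<open>X'\<close>, \<open>V'\<close> and cancelling the products
  that occur on both sides leaves sums of the inequalities proved for \<open>x\<close> and \<open>v\<close>.
\<close>

lemma interlaced_step:
  assumes n: "0 < n"
    and x0: "x' 0 = x 0"
    and xS: "\<And>j. x' (Suc j) = x (Suc j) + x j + v j"
    and v': "\<And>j. v' j = v j + x' j"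
  shows "interlaced (Suc n) x' v'"
  unfolding interlaced_def
proof (intro conjI allI impI)
  fix j
  show "0 < x' j" if "j < Suc n"
  proof (cases j)
    case 0
    then show ?thesis
      using n x0 interlaced_pos(1)[of 0] by simp
  next
    case (Suc i)
    then show ?thesis
      using that xS[of i] interlaced_pos[of i] interlaced_nonneg(1)[of "Suc i"] by simp
  qed
  then show "0 < v' j" if "j < Suc n"
    using that v' interlaced_nonneg(2)[of j] by (simp add: add_nonneg_pos)
  show x'_zero: "x' j = 0" if "Suc n \<le> j"
    using that xS interlaced_zero by (cases j) auto
  show "v' j = 0" if "Suc n \<le> j"
    using that v' x'_zero interlaced_zero by auto
  show "v' (Suc j) * x' j \<le> v' j * x' (Suc j)"
  proof (cases j)
    case 0
    have "0 \<le> v 0 * (x 0 + v 0)"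
      by (intro mult_nonneg_nonneg add_nonneg_nonneg interlaced_nonneg)
    then show ?thesis
      using 0 interlaced_ratio[of 0] by (simp add: x0 xS v' algebra_simps)
  next
    case (Suc i)
    show ?thesis
      using Suc interlaced_ratio[of "Suc i"] interlaced_log_concave_snd[of i] interlaced_mixed[of i]
      by (simp add: xS v' algebra_simps)
  qed
  show "v' j * x' (Suc (Suc j)) \<le> v' (Suc j) * x' (Suc j)"
  proof (cases j)
    case 0
    have "0 \<le> (x 0 + v 0) * (x 1 + x 0 + v 0)"
      by (intro mult_nonneg_nonneg add_nonneg_nonneg interlaced_nonneg)
    then show ?thesis
      using 0 interlaced_shifted_ratio[of 0] interlaced_log_concave_fst[of 0]
      by (simp add: x0 xS v' algebra_simps)
  next
    case (Suc i)
    show ?thesis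
      using Suc interlaced_shifted_ratio[of "Suc i"] interlaced_log_concave_fst[of "Suc i"]
        interlaced_far_fst[of i] interlaced_far_mixed[of i]
        interlaced_log_concave_fst[of i] interlaced_log_concave_snd[of i]
        interlaced_mixed[of i] interlaced_shifted_ratio[of i]
      by (simp add: xS v' algebra_simps)
  qed
qed

end

section \<open>Counting order-consecutive partition sequences\<close>

text \<open>
  Removing the last part changes the underlying set to an arbitrary interval, hence sequences
  are considered over any set \<open>A\<close>.
\<close>

definition oc_sequences :: "nat set \<Rightarrow> nat \<Rightarrow> nat set list set" where
  "oc_sequences A p =
     {s. length s = p \<and> (\<forall>i<p. s ! i \<noteq> {}) \<and> disjoint_family_on (\<lambda>i. s ! i) {..<p} \<and>
         (\<Union>i<p. s ! i) = A \<and> order_consecutive s}"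

lemma OCPS_eq_card: "OCPS n p = card (oc_sequences {1..n} p)"
  by (simp add: OCPS_def oc_sequences_def partition_sequence_def conj_assoc)

lemma finite_oc_sequences:
  assumes "finite A"
  shows "finite (oc_sequences A p)"
proof (rule finite_subset)
  show "oc_sequences A p \<subseteq> {s. set s \<subseteq> Pow A \<and> length s = p}"
    by (fastforce simp: oc_sequences_def in_set_conv_nth)
  show "finite {s. set s \<subseteq> Pow A \<and> length s = p}"
    using assms by (intro finite_lists_length_eq) simp
qed

lemma oc_sequences_unique_union:
  assumes "s \<in> oc_sequences A p" "s \<in> oc_sequences B p"
  shows "A = B"
  using assms by (auto simp: oc_sequences_def)

lemma oc_sequences_0: "oc_sequences A 0 = (if A = {} then {[]} else {})"
  by (auto simp: oc_sequences_def order_consecutive_def disjoint_family_on_def)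

lemma oc_sequences_consecutive:
  assumes "s \<in> oc_sequences A p" "p \<ge> 1"
  shows "consecutive A" "A \<noteq> {}"
proof -
  show "consecutive A"
    using assms unfolding oc_sequences_def order_consecutive_def by force
  show "A \<noteq> {}"
    using assms unfolding oc_sequences_def by force
qed

lemma oc_sequences_snoc:
  "t @ [B] \<in> oc_sequences C (Suc p) \<longleftrightarrow>
     consecutive C \<and> B \<noteq> {} \<and> B \<subseteq> C \<and> t \<in> oc_sequences (C - B) p"
proof (cases "length t = p")
  case True
  let ?s = "t @ [B]"
  have old: "?s ! i = t ! i" if "i < p" for i
    using that True by (simp add: nth_append)
  have new: "?s ! p = B"
    using True by (simp add: nth_append)
  have U: "(\<Union>i<k. ?s ! i) = (\<Union>i<k. t ! i)" if "k \<le> p" for k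
    using that old by auto
  have ne: "(\<forall>i<Suc p. ?s ! i \<noteq> {}) \<longleftrightarrow> (\<forall>i<p. t ! i \<noteq> {}) \<and> B \<noteq> {}"
    using old new by (auto simp: less_Suc_eq)
  have un: "(\<Union>i<Suc p. ?s ! i) = (\<Union>i<p. t ! i) \<union> B"
    using U[of p] new by (simp add: lessThan_Suc Un_commute)
  have dj: "disjoint_family_on (\<lambda>i. ?s ! i) {..<Suc p} \<longleftrightarrow>
      disjoint_family_on (\<lambda>i. t ! i) {..<p} \<and> (\<Union>i<p. t ! i) \<inter> B = {}"
  proof -
    have "disjoint_family_on (\<lambda>i. ?s ! i) {..<p} \<longleftrightarrow> disjoint_family_on (\<lambda>i. t ! i) {..<p}"
      using old by (auto simp: disjoint_family_on_def)
    moreover have "disjoint_family_on (\<lambda>i. ?s ! i) {..<Suc p} \<longleftrightarrow>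
        ?s ! p \<inter> (\<Union>i<p. ?s ! i) = {} \<and> disjoint_family_on (\<lambda>i. ?s ! i) {..<p}"
      unfolding lessThan_Suc by (rule disjoint_family_on_insert) simp
    ultimately show ?thesis
      using U[of p] new by auto
  qed
  have "order_consecutive ?s \<longleftrightarrow>
      (\<forall>k\<in>{1..p}. consecutive (\<Union>i<k. ?s ! i)) \<and> consecutive (\<Union>i<Suc p. ?s ! i)"
    using True by (auto simp: order_consecutive_def atLeastAtMostSuc_conv)
  then have oc: "order_consecutive ?s \<longleftrightarrow> order_consecutive t \<and> consecutive (\<Union>i<Suc p. ?s ! i)"
    using U True by (simp add: order_consecutive_def)
  define W where "W = (\<Union>i<p. t ! i)"
  have "?s \<in> oc_sequences C (Suc p) \<longleftrightarrow>
      (\<forall>i<p. t ! i \<noteq> {}) \<and> B \<noteq> {} \<and> disjoint_family_on (\<lambda>i. t ! i) {..<p} \<and>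
      order_consecutive t \<and> consecutive C \<and> W \<inter> B = {} \<and> W \<union> B = C"
    unfolding oc_sequences_def mem_Collect_eq ne dj oc un W_def[symmetric] using True by auto
  moreover have "t \<in> oc_sequences (C - B) p \<longleftrightarrow>
      (\<forall>i<p. t ! i \<noteq> {}) \<and> disjoint_family_on (\<lambda>i. t ! i) {..<p} \<and>
      order_consecutive t \<and> W = C - B"
    unfolding oc_sequences_def mem_Collect_eq W_def[symmetric] using True by blast
  moreover have "W \<inter> B = {} \<and> W \<union> B = C \<longleftrightarrow> B \<subseteq> C \<and> W = C - B"
    by blast
  ultimately show ?thesis
    by argo
qed (auto simp: oc_sequences_def)

lemma oc_sequences_map:
  assumes s: "s \<in> oc_sequences A p" and inj: "inj_on g A"
    and g: "\<And>B. B \<subseteq> A \<Longrightarrow> consecutive B \<Longrightarrow> consecutive (g ` B)"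
  shows "map ((`) g) s \<in> oc_sequences (g ` A) p"
proof -
  have len: "length s = p" and dj: "disjoint_family_on (\<lambda>i. s ! i) {..<p}"
    and un: "(\<Union>i<p. s ! i) = A" and oc: "order_consecutive s"
    using s by (auto simp: oc_sequences_def)
  have U: "(\<Union>i<k. map ((`) g) s ! i) = g ` (\<Union>i<k. s ! i)" if "k \<le> p" for k
    using that len by (auto simp: image_UN)
  have "g ` (s ! i) \<inter> g ` (s ! j) = {}" if "i < p" "j < p" "i \<noteq> j" for i j
  proof -
    have "s ! i \<subseteq> A" "s ! j \<subseteq> A" "s ! i \<inter> s ! j = {}"
      using that un dj by (auto simp: disjoint_family_on_def)
    then show ?thesis
      using inj_on_image_Int[OF inj, of "s ! i" "s ! j"] by simp
  qed
  then have dj': "disjoint_family_on (\<lambda>i. map ((`) g) s ! i) {..<p}"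
    using len by (auto simp: disjoint_family_on_def)
  have oc': "order_consecutive (map ((`) g) s)"
    unfolding order_consecutive_def
  proof
    fix k assume "k \<in> {1..length (map ((`) g) s)}"
    then have k: "k \<in> {1..length s}" "k \<le> p"
      using len by auto
    have "(\<Union>i<k. s ! i) \<subseteq> A"
      using k un by fastforce
    then show "consecutive (\<Union>i<k. map ((`) g) s ! i)"
      using U[OF k(2)] oc k(1) g by (simp add: order_consecutive_def)
  qed
  show ?thesis
    using s dj' oc' U[of p] len by (auto simp: oc_sequences_def)
qed

text \<open>
  Translation by \<open>a - 1\<close> is a bijection between the sequences over the two intervals. Its
  inverse is a truncated subtraction, which is injective only because it is applied inside \<open>{a..b}\<close>.
\<close>

lemma card_oc_sequences_interval:
  assumes "1 \<le> a" "a \<le> b"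
  shows "card (oc_sequences {a..b} p) = OCPS (b - a + 1) p"
proof -
  define c where "c = a - 1"
  define m where "m = b - a + 1"
  have ab: "{a..b} = {1 + c..m + c}"
    using assms by (auto simp: c_def m_def)
  let ?up = "\<lambda>x. x + c" and ?down = "\<lambda>x. x - c"
  have up: "?up ` {1..m} = {a..b}"
    unfolding ab by (rule image_add_atLeastAtMost')
  have down: "?down ` {a..b} = {1..m}"
    unfolding up[symmetric] image_image by simp
  have inj: "inj_on ?down {a..b}"
    unfolding ab by (auto simp: inj_on_def)
  have shift_up: "consecutive (?up ` B)" if "consecutive B" for B
    using that unfolding consecutive_def by (metis image_add_atLeastAtMost')
  have shift_down: "consecutive (?down ` B)" if "B \<subseteq> {a..b}" "consecutive B" for B
  proof -
    from that obtain i j where B: "B = {i..j}"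
      by (auto simp: consecutive_def)
    show ?thesis
    proof (cases "i \<le> j")
      case True
      then have "c \<le> i" "c \<le> j"
        using that(1) unfolding B ab by auto
      then have "B = ?up ` {i - c..j - c}"
        unfolding B image_add_atLeastAtMost' by simp
      then have "?down ` B = ?down ` ?up ` {i - c..j - c}"
        by (rule arg_cong)
      also have "\<dots> = {i - c..j - c}"
        unfolding image_image by simp
      finally show ?thesis
        by (auto simp: consecutive_def)
    qed (use that B in simp)
  qed
  have "bij_betw (map ((`) ?up)) (oc_sequences {1..m} p) (oc_sequences {a..b} p)"
  proof (rule bij_betw_byWitness[where f' = "map ((`) ?down)"])
    show "\<forall>s\<in>oc_sequences {1..m} p. map ((`) ?down) (map ((`) ?up) s) = s"
      by (simp add: image_image comp_def)
    show "\<forall>s\<in>oc_sequences {a..b} p. map ((`) ?up) (map ((`) ?down) s) = s"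
    proof
      fix s assume s: "s \<in> oc_sequences {a..b} p"
      have "?up ` ?down ` B = B" if "B \<in> set s" for B
      proof -
        have "B \<subseteq> {a..b}"
          using s that by (fastforce simp: oc_sequences_def in_set_conv_nth)
        then have "?up (?down y) = y" if "y \<in> B" for y
          using that unfolding ab by auto
        then show ?thesis
          by (simp add: image_image)
      qed
      then show "map ((`) ?up) (map ((`) ?down) s) = s"
        by (simp add: map_idI)
    qed
    show "map ((`) ?up) ` oc_sequences {1..m} p \<subseteq> oc_sequences {a..b} p"
      using oc_sequences_map[of _ "{1..m}" p ?up] shift_up up by auto
    show "map ((`) ?down) ` oc_sequences {a..b} p \<subseteq> oc_sequences {1..m} p"
      using oc_sequences_map[of _ "{a..b}" p ?down] inj shift_down down by auto
  qed
  then show ?thesis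
    unfolding OCPS_eq_card m_def by (metis bij_betw_same_card)
qed

text \<open>
  Nothing is lost by dropping the last part: it is the complement in \<open>C\<close> of the union of the others.
  It may be adjoined to a sequence over any proper subset of \<open>C\<close>, since the only new consecutiveness
  condition concerns \<open>C\<close> itself.
\<close>

lemma bij_betw_butlast_oc_sequences:
  assumes "consecutive C"
  shows "bij_betw butlast (oc_sequences C (Suc p)) (\<Union>A\<in>Pow C - {C}. oc_sequences A p)"
proof -
  have snoc: "\<exists>t B. s = t @ [B] \<and> B \<noteq> {} \<and> B \<subseteq> C \<and> t \<in> oc_sequences (C - B) p"
    if s: "s \<in> oc_sequences C (Suc p)" for s
  proof -
    have "length s = Suc p"
      using s by (simp add: oc_sequences_def)
    then obtain t B where "s = t @ [B]"
      by (cases s rule: rev_cases) auto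
    then show ?thesis
      using s oc_sequences_snoc[of t B C p] by simp
  qed
  show ?thesis
    unfolding bij_betw_def
  proof
    show "inj_on butlast (oc_sequences C (Suc p))"
    proof (rule inj_onI)
      fix s s' assume ss: "s \<in> oc_sequences C (Suc p)" "s' \<in> oc_sequences C (Suc p)"
        and eq: "butlast s = butlast s'"
      obtain t B where t: "s = t @ [B]" "B \<subseteq> C" "t \<in> oc_sequences (C - B) p"
        using snoc[OF ss(1)] by blast
      obtain t' B' where t': "s' = t' @ [B']" "B' \<subseteq> C" "t' \<in> oc_sequences (C - B') p"
        using snoc[OF ss(2)] by blast
      have "t = t'"
        using eq t t' by simp
      then have "C - B = C - B'"
        using oc_sequences_unique_union[OF t(3)] t'(3) by simp
      then show "s = s'"
        using t(1,2) t'(1,2) \<open>t = t'\<close> by auto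
    qed
    show "butlast ` oc_sequences C (Suc p) = (\<Union>A\<in>Pow C - {C}. oc_sequences A p)"
    proof (intro equalityI subsetI)
      fix t assume "t \<in> butlast ` oc_sequences C (Suc p)"
      then obtain s where s: "s \<in> oc_sequences C (Suc p)" "t = butlast s"
        by auto
      then obtain u B where "s = u @ [B]" "B \<noteq> {}" "B \<subseteq> C" "u \<in> oc_sequences (C - B) p"
        using snoc by blast
      then show "t \<in> (\<Union>A\<in>Pow C - {C}. oc_sequences A p)"
        using s by (intro UN_I[of "C - B"]) auto
    next
      fix t assume "t \<in> (\<Union>A\<in>Pow C - {C}. oc_sequences A p)"
      then obtain A where A: "A \<subset> C" "t \<in> oc_sequences A p"
        by auto
      then have "t @ [C - A] \<in> oc_sequences C (Suc p)"
        using assms unfolding oc_sequences_snoc by (auto simp: double_diff)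
      then show "t \<in> butlast ` oc_sequences C (Suc p)"
        by (metis butlast_snoc image_eqI)
    qed
  qed
qed

lemma OCPS_1:
  assumes "n \<ge> 1"
  shows "OCPS n 1 = 1"
proof -
  have C: "consecutive {1..n}"
    by (auto simp: consecutive_def)
  have "(\<Union>A\<in>Pow {1..n} - {{1..n}}. oc_sequences A 0) = {[]}"
    using assms by (auto simp: oc_sequences_0 split: if_splits)
  then show ?thesis
    using bij_betw_same_card[OF bij_betw_butlast_oc_sequences[OF C, of 0]]
    by (simp add: OCPS_eq_card)
qed

text \<open>
  The term \<open>OCPS n p\<close> on the left accounts for the improper subinterval \<open>{1..n}\<close>, so
  that the right-hand side runs over all subintervals, grouped by their right end point \<open>b\<close>.
\<close>

lemma OCPS_Suc_sum:
  assumes "p \<ge> 1"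
  shows "OCPS n (Suc p) + OCPS n p = (\<Sum>b=1..n. \<Sum>m=1..b. OCPS m p)"
proof -
  let ?C = "{1..n}"
  let ?I = "SIGMA b:{1..n}. {1..b}"
  let ?iv = "\<lambda>(b, a). {a..b::nat}"
  have C: "consecutive ?C"
    by (auto simp: consecutive_def)
  have "OCPS n (Suc p) = card (\<Union>A\<in>Pow ?C - {?C}. oc_sequences A p)"
    unfolding OCPS_eq_card by (rule bij_betw_same_card[OF bij_betw_butlast_oc_sequences[OF C]])
  also have "\<dots> = (\<Sum>A\<in>Pow ?C - {?C}. card (oc_sequences A p))"
  proof (rule card_UN_disjoint)
    show "\<forall>A\<in>Pow ?C - {?C}. finite (oc_sequences A p)"
      using finite_oc_sequences finite_subset by blast
    show "\<forall>A\<in>Pow ?C - {?C}. \<forall>B\<in>Pow ?C - {?C}. A \<noteq> B \<longrightarrow> oc_sequences A p \<inter> oc_sequences B p = {}"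
      using oc_sequences_unique_union by blast
  qed simp
  finally have "OCPS n (Suc p) + OCPS n p = (\<Sum>A\<in>Pow ?C. card (oc_sequences A p))"
    unfolding OCPS_eq_card by (subst sum.remove[of "Pow ?C" ?C]) (simp_all add: add.commute)
  \<comment> \<open>Since \<open>p \<ge> 1\<close>, only nonempty intervals carry a sequence.\<close>
  also have "\<dots> = (\<Sum>A\<in>?iv ` ?I. card (oc_sequences A p))"
  proof (rule sum.mono_neutral_right)
    show "?iv ` ?I \<subseteq> Pow ?C"
      by auto
    show "\<forall>A\<in>Pow ?C - ?iv ` ?I. card (oc_sequences A p) = 0"
    proof (intro ballI, rule ccontr)
      fix A assume A: "A \<in> Pow ?C - ?iv ` ?I" and "card (oc_sequences A p) \<noteq> 0"
      then obtain s where "s \<in> oc_sequences A p"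
        by fastforce
      then obtain a b where ab: "A = {a..b}" "a \<le> b"
        using oc_sequences_consecutive assms unfolding consecutive_def
        by (metis atLeastatMost_empty_iff)
      then have "1 \<le> a" "b \<le> n"
        using A by auto
      then have "(b, a) \<in> ?I"
        using ab by auto
      then have "?iv (b, a) \<in> ?iv ` ?I"
        by (rule imageI)
      then show False
        using A ab by simp
    qed
  qed simp
  also have "\<dots> = (\<Sum>(b, a)\<in>?I. card (oc_sequences {a..b} p))"
  proof -
    have "inj_on ?iv ?I"
      by (auto simp: inj_on_def Icc_eq_Icc)
    then show ?thesis
      by (simp add: sum.reindex case_prod_unfold)
  qed
  also have "\<dots> = (\<Sum>b=1..n. \<Sum>a=1..b. card (oc_sequences {a..b} p))"
    by (simp add: sum.Sigma)
  also have "\<dots> = (\<Sum>b=1..n. \<Sum>m=1..b. OCPS m p)"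
  proof (rule sum.cong[OF refl])
    fix b
    \<comment> \<open>Summing over the left end point \<open>a\<close> is summing over the length \<open>m = b - a + 1\<close>.\<close>
    have "(\<Sum>a=1..b. card (oc_sequences {a..b} p)) = (\<Sum>a=1..b. OCPS (b - a + 1) p)"
      by (rule sum.cong) (simp_all add: card_oc_sequences_interval)
    also have "\<dots> = (\<Sum>m=1..b. OCPS m p)"
      by (rule sum.reindex_bij_witness[where i = "\<lambda>m. b - m + 1" and j = "\<lambda>a. b - a + 1"]) auto
    finally show "(\<Sum>a=1..b. card (oc_sequences {a..b} p)) = (\<Sum>m=1..b. OCPS m p)" .
  qed
  finally show ?thesis .
qed

lemma OCPS_rec:
  assumes "p \<ge> 1"
  shows "OCPS (Suc n) (Suc p) = OCPS n (Suc p) + OCPS n p + (\<Sum>m=1..n. OCPS m p)"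
  using OCPS_Suc_sum[OF assms, of n] OCPS_Suc_sum[OF assms, of "Suc n"] by simp

section \<open>Log-concavity\<close>

text \<open>
  The induction starts at \<open>n = 1\<close>, where both rows are \<open>1, 0, 0, \<dots>\<close>. The first column has to be
  treated separately because the recurrence computes only the terms with at least two parts.
\<close>

lemma interlaced_OCPS:
  assumes "n \<ge> 1"
  shows "interlaced n (\<lambda>j. real (OCPS n (Suc j))) (\<lambda>j. \<Sum>m=1..n. real (OCPS m (Suc j)))"
  using assms
proof (induction n rule: dec_induct)
  case base
  have "OCPS 1 (Suc (Suc j)) = 0" for j
    using OCPS_Suc_sum[of "Suc j" 1] by simp
  then have "OCPS 1 (Suc j) = (if j = 0 then 1 else 0)" for j
    using OCPS_1[of 1] by (cases j) simp_all
  then show ?case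
    by (simp add: interlaced_def)
next
  case (step n)
  show ?case
  proof (rule interlaced_step[OF step.IH])
    show "0 < n"
      using step.hyps by simp
    show "real (OCPS (Suc n) (Suc 0)) = real (OCPS n (Suc 0))"
      using OCPS_1[of n] OCPS_1[of "Suc n"] step.hyps by simp
  qed (simp_all add: OCPS_rec)
qed

theorem theorem3:
  fixes n :: nat
  assumes "n \<ge> 1"
  shows "log_concave (finite_seq 1 n (\<lambda>p. real (OCPS n p)))"
  unfolding log_concave_def
proof
  fix p :: int
  let ?a = "finite_seq 1 n (\<lambda>p. real (OCPS n p))"
  show "?a (p + 1) * ?a (p - 1) \<le> (?a p)\<^sup>2"
  proof (cases "2 \<le> p \<and> p < int n")
    case True
    \<comment> \<open>The interlaced rows are indexed from \<open>0\<close>, so the term at \<open>p - 1\<close> is entry \<open>j = p - 2\<close>.\<close>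
    define j where "j = nat (p - 2)"
    have "p = int (Suc (Suc j))" "p - 1 = int (Suc j)" "p + 1 = int (Suc (Suc (Suc j)))"
      using True by (simp_all add: j_def)
    then have "?a (p - 1) = OCPS n (Suc j)" "?a p = OCPS n (Suc (Suc j))"
      "?a (p + 1) = OCPS n (Suc (Suc (Suc j)))"
      using True by (simp_all only: finite_seq_def nat_int) auto
    then show ?thesis
      using interlaced_log_concave_fst[OF interlaced_OCPS[OF assms], of j]
      by (simp add: power2_eq_square mult.commute)
  next
    case False
    then have "?a (p + 1) = 0 \<or> ?a (p - 1) = 0"
      by (auto simp: finite_seq_def)
    then show ?thesis
      by auto
  qed
qed

end
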